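(* Let $(x^\star,u^\star)\in\mathcal{X}\times\mathcal{U}$ satisfy $0=\nabla f(x^\star)+\mu_g x^\star+K^*u^\star$ and $Kx^\star\in\partial h^*(u^\star)$, where $\mathcal{X},\mathcal{U},f,h,K$ and the constants $L_f,\mu_g,\mu_{h^*}$ are as in the context. Let the iterates be generated by the algorithm APAPC (see context) with stepsizes $\gamma,\tau>0$ and parameters $(a_t)_{t\ge 0}$. For $t\ge 0$ let $\tilde\nabla h^*(v^{t+1})\in\partial h^*(v^{t+1})$ be the subgradient satisfying $v^{t+1}+\frac{\tau}{a_{t+1}}\tilde\nabla h^*(v^{t+1})=v^t+\frac{\tau}{a_{t+1}}K\hat z^t$. Then, for every $t\ge 0$, $$\begin{aligned} &\frac{1+a_{t+1}\gamma\mu_g}{2\gamma}\|z^{t+1}-x^\star\|^2+\frac{a_{t+1}^2+a_{t+1}\tau\mu_{h^*}}{2\tau}\|v^{t+1}-u^\star\|^2-\frac{a_{t+1}^2\gamma}{2+2a_{t+1}\gamma\mu_g}\|K^*(v^{t+1}-u^\star)\|^2\\ &\quad+a_{t+1}^2\,\mathcal{G}_{x^\star,u^\star}(x^{t+1},u^{t+1})\\ &\le \frac{1}{2\gamma}\|z^{t}-x^\star\|^2+\frac{a_{t+1}^2}{2\tau}\|v^{t}-u^\star\|^2-\frac{a_{t+1}^2\gamma}{2+2a_{t+1}\gamma\mu_g}\|K^*(v^{t}-u^\star)\|^2\\ &\quad-\Big(\frac1{2\gamma}-\frac{L_f}{2}\Big)\|z^{t+1}-z^t\|^2-\frac{\tau}{2}\|Kz^{t+1}-\tilde\nabla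 h^*(v^{t+1})\|^2+(a_{t+1}^2-a_{t+1})\,\mathcal{G}_{x^\star,u^\star}(x^{t},u^{t})\\ &\quad-\frac{a_{t+1}}{2L_f}\|\nabla f(y^t)-\nabla f(x^\star)\|^2-\frac{a_{t+1}^2-a_{t+1}}{2L_f}\|\nabla f(x^t)-\nabla f(y^t)\|^2. \end{aligned}$$
   Context: Setting: $\mathcal{X},\mathcal{U}$ are real Hilbert spaces; $f:\mathcal{X}\to\mathbb{R}$ is convex, differentiable and $L_f$-smooth ($\nabla f$ is $L_f$-Lipschitz), $L_f>0$; $\mu_g\ge 0$ and $g:=\frac{\mu_g}{2}\|\cdot\|^2$; standing assumption $L_f\ge\mu_g$; $h:\mathcal{U}\to\mathbb{R}\cup\{+\infty\}$ is proper, lower semicontinuous, convex; $K:\mathcal{X}\to\mathcal{U}$ is a nonzero bounded linear operator with adjoint $K^*$; $h^*$ is the convex conjugate of $h$, and $\mu_{h^*}\ge 0$ is a constant such that $h^*-\frac{\mu_{h^*}}{2}\|\cdot\|^2$ is convex. The problem is $\min_x f(x)+\frac{\mu_g}{2}\|x\|^2+h(Kx)$. $\mathrm{prox}_\phi(u):=\arg\min_{w}\{\phi(w)+\frac12\|w-u\|^2\}$. Lagrangian: $\mathcal{L}(x,u):=f(x)+\frac{\mu_g}{2}\|x\|^2+\langle Kx,u\rangle-h^*(u)$. Lagrangian gap: $\mathcal{G}_{x^\star,u^\star}(x,u):=\mathcal{L}(x,u^\star)-\mathcal{L}(x^\star,u)\in[0,+\infty]$. Convention: $0\cdot(+\infty)=0$.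 APAPC: given $\gamma>0$, $\tau>0$, a real sequence $(a_t)_{t\ge0}$ with $a_0\ge 0$ and $a_t\ge1$ for all $t\ge1$, $x^0=z^0\in\mathcal{X}$, $u^0=v^0\in\mathcal{U}$, iterate for $t\ge0$: $y^t:=(1-\frac1{a_{t+1}})x^t+\frac1{a_{t+1}}z^t$; $\hat z^t:=(1+a_{t+1}\gamma\mu_g)^{-1}\big(z^t-a_{t+1}\gamma\nabla f(y^t)-a_{t+1}\gamma K^*v^t\big)$; $v^{t+1}:=\mathrm{prox}_{\frac{\tau}{a_{t+1}}h^*}\big(v^t+\frac{\tau}{a_{t+1}}K\hat z^t\big)$; $z^{t+1}:=(1+a_{t+1}\gamma\mu_g)^{-1}\big(z^t-a_{t+1}\gamma\nabla f(y^t)-a_{t+1}\gamma K^*v^{t+1}\big)$; $x^{t+1}:=(1-\frac1{a_{t+1}})x^t+\frac1{a_{t+1}}z^{t+1}$; $u^{t+1}:=(1-\frac1{a_{t+1}})u^t+\frac1{a_{t+1}}v^{t+1}$.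
   Formalization: The formal theorem adds the stepsize condition γτ‖K‖² ≤ 1 + a_{t+1}γμ_g for the t in question; without it the claim fails, e.g. X=U=ℝ, K=id, f=0, L_f=1, μ_g=μ_{h*}=0, h*=0, x*=u*=0, a_t=1, γ=1, τ=2, z⁰=0, v⁰=1, t=0. *)

theory Defs
  imports "HOL-Analysis.Analysis"
begin

definition gradient :: "('a::real_inner \<Rightarrow> real) \<Rightarrow> 'a \<Rightarrow> 'a" where
  "gradient f x = (THE D. GDERIV f x :> D)"

text \<open>Extended-real-valued functions take values in \<^typ>\<open>ereal\<close>, whose multiplication
  satisfies \<open>0 * \<infinity> = 0\<close>.\<close>

definition proper :: "('a \<Rightarrow> ereal) \<Rightarrow> bool" where
  "proper \<phi> \<longleftrightarrow> (\<forall>x. \<phi> x \<noteq> -\<infinity>) \<and> (\<exists>x. \<phi> x \<noteq> \<infinity>)"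

definition lower_semicontinuous :: "('a::topological_space \<Rightarrow> ereal) \<Rightarrow> bool" where
  "lower_semicontinuous \<phi> \<longleftrightarrow> (\<forall>x. \<phi> x \<le> Liminf (at x) \<phi>)"

text \<open>Only applied to functions that do not take the value \<open>-\<infinity>\<close>, so that the right-hand side
  is never of the form \<open>\<infinity> - \<infinity>\<close>.\<close>

definition convex_ereal :: "('a::real_vector \<Rightarrow> ereal) \<Rightarrow> bool" where
  "convex_ereal \<phi> \<longleftrightarrow> (\<forall>x y. \<forall>s\<in>{0..1::real}.
     \<phi> ((1 - s) *\<^sub>R x + s *\<^sub>R y) \<le> ereal (1 - s) * \<phi> x + ereal s * \<phi> y)"

definition conjugate :: "('a::real_inner \<Rightarrow> ereal) \<Rightarrow> 'a \<Rightarrow> ereal" where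
  "conjugate h u = (SUP x. ereal (x \<bullet> u) - h x)"

text \<open>The subdifferential is empty outside the effective domain; for proper functions the
  finiteness condition follows from the subgradient inequality.\<close>

definition subdifferential :: "('a::real_inner \<Rightarrow> ereal) \<Rightarrow> 'a \<Rightarrow> 'a set" where
  "subdifferential \<phi> u =
     {d. \<bar>\<phi> u\<bar> \<noteq> \<infinity> \<and> (\<forall>w. \<phi> u + ereal (d \<bullet> (w - u)) \<le> \<phi> w)}"

definition prox :: "('a::real_inner \<Rightarrow> ereal) \<Rightarrow> 'a \<Rightarrow> 'a" where
  "prox \<phi> u = (ARG_MIN (\<lambda>w. \<phi> w + ereal (1/2 * (norm (w - u))\<^sup>2)) w. True)"

definition Lagrangian ::
  "('a::real_inner \<Rightarrow> real) \<Rightarrow> real \<Rightarrow> ('b::real_inner \<Rightarrow> ereal) \<Rightarrow> ('a \<Rightarrow> 'b) \<Rightarrow> 'a \<Rightarrow> 'b \<Rightarrow> ereal"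
  where
  "Lagrangian f \<mu>g h K x u =
     ereal (f x + \<mu>g / 2 * (norm x)\<^sup>2 + K x \<bullet> u) - conjugate h u"

definition Lagrangian_gap ::
  "('a::real_inner \<Rightarrow> real) \<Rightarrow> real \<Rightarrow> ('b::real_inner \<Rightarrow> ereal) \<Rightarrow> ('a \<Rightarrow> 'b)
     \<Rightarrow> 'a \<Rightarrow> 'b \<Rightarrow> 'a \<Rightarrow> 'b \<Rightarrow> ereal" where
  "Lagrangian_gap f \<mu>g h K xs us x u = Lagrangian f \<mu>g h K x us - Lagrangian f \<mu>g h K xs u"

definition APAPC ::
  "('a::real_inner \<Rightarrow> real) \<Rightarrow> real \<Rightarrow> ('b::real_inner \<Rightarrow> ereal) \<Rightarrow> ('a \<Rightarrow> 'b)
     \<Rightarrow> real \<Rightarrow> real \<Rightarrow> (nat \<Rightarrow> real)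
     \<Rightarrow> (nat \<Rightarrow> 'a) \<Rightarrow> (nat \<Rightarrow> 'a) \<Rightarrow> (nat \<Rightarrow> 'a) \<Rightarrow> (nat \<Rightarrow> 'a) \<Rightarrow> (nat \<Rightarrow> 'b) \<Rightarrow> (nat \<Rightarrow> 'b) \<Rightarrow> bool"
  where
  "APAPC f \<mu>g h K \<gamma> \<tau> a x y z zhat u v \<longleftrightarrow>
     x 0 = z 0 \<and> u 0 = v 0 \<and>
     (\<forall>t. y t = (1 - 1 / a (Suc t)) *\<^sub>R x t + (1 / a (Suc t)) *\<^sub>R z t) \<and>
     (\<forall>t. zhat t = inverse (1 + a (Suc t) * \<gamma> * \<mu>g) *\<^sub>R
        (z t - (a (Suc t) * \<gamma>) *\<^sub>R gradient f (y t) - (a (Suc t) * \<gamma>) *\<^sub>R adjoint K (v t))) \<and>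
     (\<forall>t. v (Suc t) = prox (\<lambda>w. ereal (\<tau> / a (Suc t)) * conjugate h w)
        (v t + (\<tau> / a (Suc t)) *\<^sub>R K (zhat t))) \<and>
     (\<forall>t. z (Suc t) = inverse (1 + a (Suc t) * \<gamma> * \<mu>g) *\<^sub>R
        (z t - (a (Suc t) * \<gamma>) *\<^sub>R gradient f (y t) - (a (Suc t) * \<gamma>) *\<^sub>R adjoint K (v (Suc t)))) \<and>
     (\<forall>t. x (Suc t) = (1 - 1 / a (Suc t)) *\<^sub>R x t + (1 / a (Suc t)) *\<^sub>R z (Suc t)) \<and>
     (\<forall>t. u (Suc t) = (1 - 1 / a (Suc t)) *\<^sub>R u t + (1 / a (Suc t)) *\<^sub>R v (Suc t))"

end

theory Submission
  imports Defs
begin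

text \<open>With \<open>F = f + \<mu>\<^sub>g/2 \<parallel>\<cdot>\<parallel>\<^sup>2\<close> and \<open>\<alpha> = a (t + 1)\<close>, the difference
  \<open>\<alpha>\<^sup>2 G (x (t+1), u (t+1)) - (\<alpha>\<^sup>2 - \<alpha>) G (x t, u t)\<close> of Lagrangian gaps splits into a primal and a
  dual part. The primal part is bounded by Nesterov's argument: the descent lemma from \<open>y t\<close> to
  \<open>x (t+1)\<close>, and the convexity inequality for smooth functions (with its squared gradient
  difference) at \<open>y t\<close>, towards \<open>xs\<close> and towards \<open>x t\<close>, weighted by \<open>\<alpha>\<close> and \<open>\<alpha>\<^sup>2 - \<alpha>\<close>. The dual
  part is bounded by the strong convexity of \<open>h\<^sup>*\<close> at \<open>v (t+1)\<close>. What remains is the cross term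
  \<open>\<alpha> \<langle>d t - K z (t+1), v (t+1) - us\<rangle>\<close>. The definition of \<open>zhat\<close> turns \<open>d t - K z (t+1)\<close> into
  \<open>(\<alpha>/\<tau>) M (v t - v (t+1))\<close> with \<open>M = I - (\<gamma>\<tau>/(1 + \<alpha>\<gamma>\<mu>\<^sub>g)) K K\<^sup>*\<close>, and the stepsize condition gives
  \<open>0 \<le> M \<le> I\<close>, hence \<open>\<parallel>M w\<parallel>\<^sup>2 \<le> \<langle>M w, w\<rangle>\<close>.\<close>

section \<open>Riesz representation, adjoints and gradients\<close>

text \<open>The representer is the minimizer of \<open>J\<close>: a minimizing sequence is Cauchy by
  the parallelogram law, and the first-order condition at its limit \<open>D\<close> is the claim.
  Adjoints and gradients are both obtained from this.\<close>

lemma riesz_representation: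
  fixes \<phi> :: "'a::{real_inner, complete_space} \<Rightarrow> real"
  assumes "bounded_linear \<phi>"
  shows "\<exists>D. \<forall>p. \<phi> p = D \<bullet> p"
proof -
  interpret bounded_linear \<phi> by fact
  define J where "J w = (norm w)\<^sup>2 / 2 - \<phi> w" for w
  obtain B where B: "\<And>w. norm (\<phi> w) \<le> norm w * B"
    using bounded by blast
  have low: "- (B\<^sup>2) / 2 \<le> J w" for w
  proof -
    have "\<phi> w \<le> norm w * B" using B[of w] by simp
    moreover have "0 \<le> (norm w - B)\<^sup>2" by simp
    ultimately show ?thesis unfolding J_def power2_diff by simp
  qed
  define m where "m = Inf (range J)"
  have bdd: "bdd_below (range J)" by (rule bdd_belowI2[OF low])
  have m_le: "m \<le> J w" for w
    unfolding m_def by (rule cInf_lower) (use bdd in auto)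
  have "\<exists>w. J w < m + 1 / real (Suc n)" for n
    using cInf_lessD[of "range J" "m + 1 / real (Suc n)"] by (auto simp: m_def)
  then obtain w where w: "\<And>n. J (w n) < m + 1 / real (Suc n)" by metis
  \<comment> \<open>The linear parts cancel, so this is the parallelogram law. Values within
    \<open>1 / real (Suc N)\<close> of the infimum at both ends, and at least \<open>m\<close> at
    the midpoint, give the constant 8 below.\<close>
  have par: "(norm (p - q))\<^sup>2 = 4 * (J p + J q - 2 * J ((1/2) *\<^sub>R (p + q)))" for p q
    by (simp add: J_def add scale power2_norm_eq_inner inner_add inner_diff inner_commute field_simps)
  have dist_w: "(norm (w i - w j))\<^sup>2 < 8 / real (Suc N)" if "i \<ge> N" "j \<ge> N" for i j N
  proof -
    have "1 / real (Suc i) \<le> 1 / real (Suc N)" "1 / real (Suc j) \<le> 1 / real (Suc N)"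
      using that by (auto intro!: divide_left_mono)
    moreover have "8 / real (Suc N) = 8 * (1 / real (Suc N))" by simp
    ultimately show ?thesis
      using par[of "w i" "w j"] w[of i] w[of j] m_le[of "(1/2) *\<^sub>R (w i + w j)"] by argo
  qed
  have "Cauchy w"
  proof (rule CauchyI)
    fix e :: real assume "e > 0"
    then obtain N where N: "8 / e\<^sup>2 < real (Suc N)"
      using reals_Archimedean2[of "8 / e\<^sup>2"] by (metis less_trans lessI of_nat_less_iff)
    have "norm (w i - w j) < e" if "i \<ge> N" "j \<ge> N" for i j
    proof (rule power_less_imp_less_base)
      have "8 / real (Suc N) < e\<^sup>2"
        using N \<open>e > 0\<close> by (simp add: field_simps)
      then show "(norm (w i - w j))\<^sup>2 < e\<^sup>2" using dist_w[OF that] by linarith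
    qed (use \<open>e > 0\<close> in auto)
    then show "\<exists>M. \<forall>i\<ge>M. \<forall>j\<ge>M. norm (w i - w j) < e" by blast
  qed
  then obtain D where D: "w \<longlonglongrightarrow> D"
    using Cauchy_convergent_iff convergent_def by blast
  have "(\<lambda>n. J (w n)) \<longlonglongrightarrow> J D"
    unfolding J_def by (intro tendsto_intros tendsto D) simp
  moreover have "(\<lambda>n. m + 1 / real (Suc n)) \<longlonglongrightarrow> m"
    using tendsto_add[OF tendsto_const LIMSEQ_Suc[OF lim_1_over_n]] by simp
  ultimately have JD: "J D \<le> m"
    by (rule LIMSEQ_le) (use w less_imp_le in blast)
  have "\<phi> p = D \<bullet> p" for p
  proof (cases "p = 0")
    case False
    define e where "e = D \<bullet> p - \<phi> p"
    \<comment> \<open>The minimizer of the quadratic \<open>s * e + s^2 * (norm p)^2 / 2\<close>. A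
      nonzero \<open>e\<close> would push \<open>J\<close> below its minimum.\<close>
    define s where "s = - e / (norm p)\<^sup>2"
    have "J (D + s *\<^sub>R p) = J D + s * e + s\<^sup>2 * (norm p)\<^sup>2 / 2"
      by (simp add: J_def e_def add scale power2_norm_eq_inner inner_add inner_commute
          power2_eq_square[of s] field_simps)
    moreover have "s * e + s\<^sup>2 * (norm p)\<^sup>2 / 2 = - (e\<^sup>2 / (2 * (norm p)\<^sup>2))"
      using False unfolding s_def by (simp add: power2_eq_square divide_simps)
    ultimately have "e\<^sup>2 / (2 * (norm p)\<^sup>2) \<le> 0"
      using m_le[of "D + s *\<^sub>R p"] JD by linarith
    then have "e = 0" using False by (simp add: divide_le_0_iff)
    then show ?thesis by (simp add: e_def)
  qed (simp add: zero)
  then show ?thesis by blast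
qed

text \<open>\<open>adjoint\<close> is defined by choice, so the identity depends on the existence of
  some adjoint map; representing \<open>K p \<bullet> q\<close> as a functional of \<open>p\<close>,
  for each \<open>q\<close>, provides one.\<close>

lemma inner_adjoint:
  fixes K :: "'a::{real_inner, complete_space} \<Rightarrow> 'b::real_inner"
  assumes "bounded_linear K"
  shows "K p \<bullet> q = p \<bullet> adjoint K q"
proof -
  have "\<exists>D. \<forall>p. K p \<bullet> q = D \<bullet> p" for q
    by (intro riesz_representation bounded_linear_intros assms)
  then obtain A where "\<And>p q. K p \<bullet> q = A q \<bullet> p" by metis
  then have "\<forall>p q. K p \<bullet> q = p \<bullet> A q" by (simp add: inner_commute)
  then show ?thesis using adjoint_unique by metis
qed

lemma adjoint_diff:
  fixes K :: "'a::{real_inner, complete_space} \<Rightarrow> 'b::real_inner"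
  assumes "bounded_linear K"
  shows "adjoint K (p - q) = adjoint K p - adjoint K q"
proof (rule vector_eq_ldot[THEN iffD1], rule allI)
  fix r
  show "r \<bullet> adjoint K (p - q) = r \<bullet> (adjoint K p - adjoint K q)"
    by (simp add: inner_adjoint[OF assms, symmetric] inner_diff_right)
qed

text \<open>\<open>gradient\<close> is a definite description: Riesz representation of the
  derivative gives existence, uniqueness of derivatives gives uniqueness.\<close>

lemma GDERIV_gradient:
  fixes f :: "'a::{real_inner, complete_space} \<Rightarrow> real"
  assumes "f differentiable (at p)"
  shows "GDERIV f p :> gradient f p"
proof -
  obtain F where F: "(f has_derivative F) (at p)"
    using assms unfolding differentiable_def by blast
  then obtain D where "\<forall>q. F q = D \<bullet> q"
    using riesz_representation has_derivative_bounded_linear by blast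
  then have "F = (\<lambda>q. q \<bullet> D)" by (auto simp: inner_commute)
  then have D: "GDERIV f p :> D" using F by (simp add: gderiv_def)
  moreover have "E = D" if "GDERIV f p :> E" for E
  proof -
    have "(\<lambda>q. q \<bullet> E) = (\<lambda>q. q \<bullet> D)"
      using has_derivative_unique that D unfolding gderiv_def by blast
    then show ?thesis by (metis vector_eq_ldot)
  qed
  ultimately show ?thesis unfolding gradient_def by (rule theI)
qed

section \<open>Inequalities for smooth convex functions\<close>

lemma DERIV_along_line:
  fixes f :: "'a::{real_inner, complete_space} \<Rightarrow> real"
  assumes "\<And>p. f differentiable (at p)"
  shows "((\<lambda>s. f (p + s *\<^sub>R q)) has_real_derivative (q \<bullet> gradient f (p + s *\<^sub>R q))) (at s)"
proof -
  have f: "(f has_derivative (\<lambda>h. h \<bullet> gradient f (p + s *\<^sub>R q))) (at (p + s *\<^sub>R q))"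
    using GDERIV_gradient[OF assms] unfolding gderiv_def .
  have "((\<lambda>s. p + s *\<^sub>R q) has_derivative (\<lambda>h. h *\<^sub>R q)) (at s)"
    by (auto intro!: derivative_eq_intros)
  from has_derivative_compose[OF this f] show ?thesis
    by (simp add: has_field_derivative_def mult.commute[of _ "q \<bullet> _"] o_def)
qed

text \<open>Convexity bounds every difference quotient along the segment by
  \<open>f q - f p\<close>; as \<open>s\<close> tends to 0 from the right, the quotients tend to the
  directional derivative.\<close>

lemma convex_gradient_ineq:
  fixes f :: "'a::{real_inner, complete_space} \<Rightarrow> real"
  assumes "convex_on UNIV f" and "\<And>p. f differentiable (at p)"
  shows "f p + gradient f p \<bullet> (q - p) \<le> f q"
proof -
  define g where "g s = f (p + s *\<^sub>R (q - p))" for s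
  have "(g has_real_derivative ((q - p) \<bullet> gradient f p)) (at_right 0)"
    unfolding g_def using DERIV_along_line[OF assms(2), of p "q - p" 0]
    by (auto intro: DERIV_subset)
  then have lim: "((\<lambda>s. (g s - g 0) / s) \<longlongrightarrow> (q - p) \<bullet> gradient f p) (at_right 0)"
    by (simp add: has_field_derivative_iff)
  have "\<forall>\<^sub>F s in at_right 0. (g s - g 0) / s \<le> f q - f p"
    unfolding eventually_at_right_field
  proof (intro exI[of _ 1] conjI allI impI)
    fix s :: real assume s: "0 < s" "s < 1"
    have "g s = f ((1 - s) *\<^sub>R p + s *\<^sub>R q)" by (simp add: g_def algebra_simps)
    also have "\<dots> \<le> (1 - s) * f p + s * f q"
      using convex_onD[OF assms(1), of s p q] s by simp
    finally show "(g s - g 0) / s \<le> f q - f p"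
      using s by (simp add: g_def field_simps)
  qed simp
  from tendsto_upperbound[OF lim this] show ?thesis
    by (simp add: inner_commute)
qed

text \<open>Monotonicity replaces integration: after the linear and quadratic terms are subtracted,
  \<open>f\<close> along the segment has nonpositive derivative, by Cauchy-Schwarz and the Lipschitz
  bound.\<close>

lemma descent_lemma:
  fixes f :: "'a::{real_inner, complete_space} \<Rightarrow> real"
  assumes diff: "\<And>p. f differentiable (at p)" and lip: "L-lipschitz_on UNIV (gradient f)"
  shows "f q \<le> f p + gradient f p \<bullet> (q - p) + L / 2 * (norm (q - p))\<^sup>2"
proof -
  define r where "r = q - p"
  define g where "g s = f (p + s *\<^sub>R r) - s * (r \<bullet> gradient f p) - L / 2 * s\<^sup>2 * (norm r)\<^sup>2" for s
  have "g 1 \<le> g 0"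
  proof (rule DERIV_nonpos_imp_nonincreasing[of 0 1 g])
    fix s :: real assume s: "0 \<le> s" "s \<le> 1"
    have g': "(g has_real_derivative
        (r \<bullet> gradient f (p + s *\<^sub>R r) - r \<bullet> gradient f p - L * s * (norm r)\<^sup>2)) (at s)"
      unfolding g_def
      by (auto intro!: derivative_eq_intros DERIV_along_line[OF diff])
    have "r \<bullet> (gradient f (p + s *\<^sub>R r) - gradient f p) \<le> L * s * (norm r)\<^sup>2"
    proof -
      have "r \<bullet> (gradient f (p + s *\<^sub>R r) - gradient f p)
          \<le> norm r * norm (gradient f (p + s *\<^sub>R r) - gradient f p)"
        by (rule norm_cauchy_schwarz)
      also have "\<dots> \<le> norm r * (L * norm (s *\<^sub>R r))"
        using lipschitz_onD[OF lip, of "p + s *\<^sub>R r" p]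
        by (intro mult_left_mono) (auto simp: dist_norm)
      finally show ?thesis using s by (simp add: power2_eq_square ac_simps)
    qed
    then show "\<exists>D. (g has_real_derivative D) (at s) \<and> D \<le> 0"
      using g' by (auto simp: inner_diff_right)
  qed simp
  then show ?thesis by (simp add: g_def r_def inner_commute)
qed

text \<open>The tangent at \<open>p\<close> is compared with the quadratic upper bound at \<open>q\<close>, both evaluated at the
  gradient step \<open>q - (\<nabla>f q - \<nabla>f p) / L\<close>.\<close>

lemma convex_smooth_gradient_ineq:
  fixes f :: "'a::{real_inner, complete_space} \<Rightarrow> real"
  assumes conv: "convex_on UNIV f" and diff: "\<And>p. f differentiable (at p)"
    and lip: "L-lipschitz_on UNIV (gradient f)" and "L > 0"
  shows "f p + gradient f p \<bullet> (q - p) + 1 / (2 * L) * (norm (gradient f q - gradient f p))\<^sup>2 \<le> f q"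
proof -
  define r where "r = gradient f q - gradient f p"
  define w where "w = q - (1 / L) *\<^sub>R r"
  have "f p + gradient f p \<bullet> (w - p) \<le> f w"
    by (rule convex_gradient_ineq[OF conv diff])
  moreover have "f w \<le> f q + gradient f q \<bullet> (w - q) + L / 2 * (norm (w - q))\<^sup>2"
    by (rule descent_lemma[OF diff lip])
  moreover have "gradient f p \<bullet> (w - p) = gradient f p \<bullet> (q - p) - (gradient f p \<bullet> r) / L"
    by (simp add: w_def inner_diff_right)
  moreover have "gradient f q \<bullet> (w - q) = - ((gradient f q \<bullet> r) / L)"
    by (simp add: w_def)
  moreover have "(gradient f q \<bullet> r) / L - (gradient f p \<bullet> r) / L = (norm r)\<^sup>2 / L"
    by (simp add: r_def power2_norm_eq_inner inner_diff_left diff_divide_distrib)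
  moreover have "L / 2 * (norm (w - q))\<^sup>2 = (norm r)\<^sup>2 / L / 2"
    using \<open>L > 0\<close> by (simp add: w_def power_divide power2_eq_square field_simps)
  moreover have "1 / (2 * L) * (norm r)\<^sup>2 = (norm r)\<^sup>2 / L / 2" by simp
  ultimately show ?thesis unfolding r_def[symmetric] by argo
qed

section \<open>One-step estimates for the primal and dual variables\<close>

lemma norm_convex_combination:
  fixes p q :: "'a::real_inner"
  shows "(norm ((1 - s) *\<^sub>R p + s *\<^sub>R q))\<^sup>2
    = (1 - s) * (norm p)\<^sup>2 + s * (norm q)\<^sup>2 - s * (1 - s) * (norm (p - q))\<^sup>2"
  by (simp add: power2_norm_eq_inner inner_add inner_diff inner_commute algebra_simps)

text \<open>Here \<open>p\<close> stands for \<open>adjoint K (v (Suc t))\<close> and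
  \<open>w\<close> for \<open>xs\<close>. The term in \<open>f\<close> is treated explicitly at
  \<open>y\<close>, the quadratic term implicitly at \<open>z'\<close>.\<close>

lemma primal_step:
  fixes f :: "'a::{real_inner, complete_space} \<Rightarrow> real"
  assumes conv: "convex_on UNIV f" and diff: "\<And>p. f differentiable (at p)"
    and lip: "L-lipschitz_on UNIV (gradient f)" and L: "L > 0"
    and \<mu>: "\<mu> \<ge> 0" and \<gamma>: "\<gamma> > 0" and \<alpha>: "\<alpha> \<ge> 1"
    and y: "y = (1 - 1 / \<alpha>) *\<^sub>R x + (1 / \<alpha>) *\<^sub>R z"
    and z': "z' = inverse (1 + \<alpha> * \<gamma> * \<mu>) *\<^sub>R (z - (\<alpha> * \<gamma>) *\<^sub>R gradient f y - (\<alpha> * \<gamma>) *\<^sub>R p)"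
    and x': "x' = (1 - 1 / \<alpha>) *\<^sub>R x + (1 / \<alpha>) *\<^sub>R z'"
  shows "\<alpha>\<^sup>2 * (f x' + \<mu> / 2 * (norm x')\<^sup>2) - (\<alpha>\<^sup>2 - \<alpha>) * (f x + \<mu> / 2 * (norm x)\<^sup>2)
      - \<alpha> * (f w + \<mu> / 2 * (norm w)\<^sup>2)
    \<le> 1 / (2 * \<gamma>) * (norm (z - w))\<^sup>2 - (1 + \<alpha> * \<gamma> * \<mu>) / (2 * \<gamma>) * (norm (z' - w))\<^sup>2
      - (1 / (2 * \<gamma>) - L / 2) * (norm (z' - z))\<^sup>2 - \<alpha> * (p \<bullet> (z' - w))
      - \<alpha> / (2 * L) * (norm (gradient f y - gradient f w))\<^sup>2
      - (\<alpha>\<^sup>2 - \<alpha>) / (2 * L) * (norm (gradient f x - gradient f y))\<^sup>2"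
proof -
  let ?G = "gradient f y"
  define nw where "nw = 1 / (2 * L) * (norm (?G - gradient f w))\<^sup>2"
  define nx where "nx = 1 / (2 * L) * (norm (gradient f x - ?G))\<^sup>2"
  have \<alpha>0: "\<alpha> > 0" and \<alpha>2: "\<alpha>\<^sup>2 - \<alpha> \<ge> 0"
    using \<alpha> by (auto simp: power2_eq_square)
  \<comment> \<open>The factor \<open>1 / \<alpha>\<close> cancels against the weight \<alpha>^2, so
    the quadratic term of the descent lemma becomes \<open>L / 2\<close> times the squared norm of
    \<open>z' - z\<close>.\<close>
  have x'y: "x' - y = (1 / \<alpha>) *\<^sub>R (z' - z)"
    by (simp add: x' y algebra_simps)

  have "f x' \<le> f y + ?G \<bullet> (x' - y) + L / 2 * (norm (x' - y))\<^sup>2"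
    by (rule descent_lemma[OF diff lip])
  then have "\<alpha>\<^sup>2 * f x' \<le> \<alpha>\<^sup>2 * (f y + ?G \<bullet> (x' - y) + L / 2 * (norm (x' - y))\<^sup>2)"
    by (simp add: mult_left_mono)
  also have "\<dots> = \<alpha>\<^sup>2 * f y + \<alpha> * (?G \<bullet> (z' - z)) + L / 2 * (norm (z' - z))\<^sup>2"
    unfolding x'y inner_scaleR_right norm_scaleR power_mult_distrib
    using \<alpha>0 by (simp add: power2_eq_square field_simps)
  finally have 1: "\<alpha>\<^sup>2 * f x' \<le> \<alpha>\<^sup>2 * f y + \<alpha> * (?G \<bullet> (z' - z)) + L / 2 * (norm (z' - z))\<^sup>2" .

  have "f y + ?G \<bullet> (w - y) + nw \<le> f w"
    using convex_smooth_gradient_ineq[OF conv diff lip L, of y w]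
    by (simp add: nw_def norm_minus_commute)
  then have 2: "\<alpha> * (f y + ?G \<bullet> (w - y) + nw) \<le> \<alpha> * f w"
    using \<alpha>0 by (simp add: mult_left_mono)
  have "f y + ?G \<bullet> (x - y) + nx \<le> f x"
    using convex_smooth_gradient_ineq[OF conv diff lip L, of y x] by (simp add: nx_def)
  then have 3: "(\<alpha>\<^sup>2 - \<alpha>) * (f y + ?G \<bullet> (x - y) + nx) \<le> (\<alpha>\<^sup>2 - \<alpha>) * f x"
    using \<alpha>2 by (simp add: mult_left_mono)
  \<comment> \<open>The choice of \<open>y\<close> makes the weighted displacements
    \<open>w - y\<close> and \<open>x - y\<close> add up to \<open>\<alpha> (w - z)\<close>;
    \<open>x\<close> and \<open>y\<close> disappear from the linear terms.\<close>
  have "\<alpha> * (?G \<bullet> y) = (\<alpha> - 1) * (?G \<bullet> x) + ?G \<bullet> z"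
    using \<alpha>0 by (simp add: y inner_add_right field_simps)
  then have "\<alpha> * (\<alpha> * (?G \<bullet> y)) = \<alpha> * ((\<alpha> - 1) * (?G \<bullet> x) + ?G \<bullet> z)"
    by simp
  then have 4: "\<alpha> * (?G \<bullet> (w - y)) + (\<alpha>\<^sup>2 - \<alpha>) * (?G \<bullet> (x - y)) = \<alpha> * (?G \<bullet> (w - z))"
    by (simp add: inner_diff_right power2_eq_square algebra_simps)

  have "(norm x')\<^sup>2 \<le> (1 - 1 / \<alpha>) * (norm x)\<^sup>2 + 1 / \<alpha> * (norm z')\<^sup>2"
    unfolding x' norm_convex_combination using \<alpha> by simp
  then have "\<alpha>\<^sup>2 * (norm x')\<^sup>2 \<le> \<alpha>\<^sup>2 * ((1 - 1 / \<alpha>) * (norm x)\<^sup>2 + 1 / \<alpha> * (norm z')\<^sup>2)"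
    by (simp add: mult_left_mono)
  also have "\<dots> = (\<alpha>\<^sup>2 - \<alpha>) * (norm x)\<^sup>2 + \<alpha> * (norm z')\<^sup>2"
    using \<alpha>0 by (simp add: power2_eq_square field_simps)
  finally have "\<mu> / 2 * (\<alpha>\<^sup>2 * (norm x')\<^sup>2)
      \<le> \<mu> / 2 * ((\<alpha>\<^sup>2 - \<alpha>) * (norm x)\<^sup>2 + \<alpha> * (norm z')\<^sup>2)"
    using \<mu> by (simp add: mult_left_mono)
  then have 5: "\<alpha>\<^sup>2 * (\<mu> / 2 * (norm x')\<^sup>2)
      \<le> (\<alpha>\<^sup>2 - \<alpha>) * (\<mu> / 2 * (norm x)\<^sup>2) + \<alpha> * (\<mu> / 2 * (norm z')\<^sup>2)"
    by argo

  \<comment> \<open>Clearing the inverse shows the backward step: \<open>z - z'\<close> is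
    \<alpha>\<gamma> times \<open>?G + \<mu> z' + p\<close>, with the quadratic's gradient taken at
    the new point. The three-point identity then produces the squared distances.\<close>
  have "(1 + \<alpha> * \<gamma> * \<mu>) *\<^sub>R z' = z - (\<alpha> * \<gamma>) *\<^sub>R ?G - (\<alpha> * \<gamma>) *\<^sub>R p"
    using \<alpha>0 \<gamma> \<mu> add_pos_nonneg[of 1 "\<alpha> * \<gamma> * \<mu>"] by (simp add: z')
  then have "(z - z') \<bullet> (z' - w) = ((\<alpha> * \<gamma>) *\<^sub>R (?G + \<mu> *\<^sub>R z' + p)) \<bullet> (z' - w)"
    by (intro arg_cong2[of _ _ _ _ "(\<bullet>)"] refl) (simp add: algebra_simps)
  then have "\<alpha> * (?G \<bullet> (z' - w)) + \<alpha> * \<mu> * (z' \<bullet> (z' - w)) + \<alpha> * (p \<bullet> (z' - w))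
      = (z - z') \<bullet> (z' - w) / \<gamma>"
    using \<gamma> by (simp add: inner_add_left field_simps)
  moreover have "(z - z') \<bullet> (z' - w) = ((norm (z - w))\<^sup>2 - (norm (z' - w))\<^sup>2 - (norm (z' - z))\<^sup>2) / 2"
    by (simp add: power2_norm_eq_inner inner_diff inner_commute)
  ultimately have 6: "\<alpha> * (?G \<bullet> (z' - w)) + \<alpha> * \<mu> * (z' \<bullet> (z' - w)) + \<alpha> * (p \<bullet> (z' - w))
      = 1 / (2 * \<gamma>) * (norm (z - w))\<^sup>2 - 1 / (2 * \<gamma>) * (norm (z' - w))\<^sup>2
        - 1 / (2 * \<gamma>) * (norm (z' - z))\<^sup>2"
    by (simp add: diff_divide_distrib)
  \<comment> \<open>Expanding the quadratic exactly around \<open>z'\<close> leaves the square of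
    \<open>z' - w\<close>; this is the source of the extra \<alpha>\<gamma>\<mu> in the coefficient
    of that distance.\<close>
  have 7: "\<mu> / 2 * (norm z')\<^sup>2
      = \<mu> / 2 * (norm w)\<^sup>2 + \<mu> * (z' \<bullet> (z' - w)) - \<mu> / 2 * (norm (z' - w))\<^sup>2"
    by (simp add: power2_norm_eq_inner inner_diff inner_commute algebra_simps)
  have 7: "\<alpha> * (\<mu> / 2 * (norm z')\<^sup>2) = \<alpha> * (\<mu> / 2 * (norm w)\<^sup>2)
      + \<alpha> * \<mu> * (z' \<bullet> (z' - w)) - \<alpha> * \<mu> / 2 * (norm (z' - w))\<^sup>2"
    unfolding 7 by (simp add: field_simps)
  have 8: "(1 + \<alpha> * \<gamma> * \<mu>) / (2 * \<gamma>) * (norm (z' - w))\<^sup>2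
      = 1 / (2 * \<gamma>) * (norm (z' - w))\<^sup>2 + \<alpha> * \<mu> / 2 * (norm (z' - w))\<^sup>2"
    using \<gamma> by (simp add: field_simps)
  have 9: "\<alpha> * (?G \<bullet> (z' - w)) = \<alpha> * (?G \<bullet> (z' - z)) - \<alpha> * (?G \<bullet> (w - z))"
    by (simp add: inner_diff_right algebra_simps)
  have "\<alpha> / (2 * L) * (norm (?G - gradient f w))\<^sup>2 = \<alpha> * nw"
    "(\<alpha>\<^sup>2 - \<alpha>) / (2 * L) * (norm (gradient f x - ?G))\<^sup>2 = (\<alpha>\<^sup>2 - \<alpha>) * nx"
    by (simp_all add: nw_def nx_def)
  then show ?thesis
    using 1 2 3 4 5 6 7 8 9 unfolding distrib_left left_diff_distrib by argo
qed

text \<open>Here \<sigma> is \<open>\<gamma> / (1 + \<alpha>\<gamma>\<mu>)\<close> and M is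
  \<open>I - \<sigma>\<tau> K K*\<close>. Polarization of the form of M gives the differences of
  squares, minus \<open>\<alpha>^2 / (2 \<tau>)\<close> times the form at \<open>v - v'\<close>.
  That term dominates the last one, because \<open>d - K z'\<close> is
  \<open>\<alpha> / \<tau>\<close> times M applied to \<open>v - v'\<close>.\<close>

lemma dual_step:
  fixes K :: "'a::{real_inner, complete_space} \<Rightarrow> 'b::real_inner"
  assumes K: "bounded_linear K" and \<tau>: "\<tau> > 0" and \<alpha>: "\<alpha> > 0" and \<sigma>: "\<sigma> \<ge> 0"
    and step: "\<sigma> * \<tau> * (onorm K)\<^sup>2 \<le> 1"
    and eq: "v' + (\<tau> / \<alpha>) *\<^sub>R d = v + (\<tau> / \<alpha>) *\<^sub>R K (z' + (\<alpha> * \<sigma>) *\<^sub>R adjoint K (v' - v))"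
  shows "\<alpha> * ((d - K z') \<bullet> (v' - w))
    \<le> \<alpha>\<^sup>2 / (2 * \<tau>) * ((norm (v - w))\<^sup>2 - (norm (v' - w))\<^sup>2)
      + \<alpha>\<^sup>2 * \<sigma> / 2 * ((norm (adjoint K (v' - w)))\<^sup>2 - (norm (adjoint K (v - w)))\<^sup>2)
      - \<tau> / 2 * (norm (K z' - d))\<^sup>2"
proof -
  interpret K: bounded_linear K by fact
  define r q where "r = v - v'" and "q = v' - w"
  let ?A = "adjoint K"
  define B where "B = K (?A r)"
  have Ar: "?A (v' - v) = - ?A r"
    by (simp add: r_def adjoint_diff[OF K])
  have vw: "v - w = r + q" by (simp add: r_def q_def)
  have Avw: "?A (v - w) = ?A r + ?A q"
    by (simp add: r_def q_def adjoint_diff[OF K])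
  have "(\<tau> / \<alpha>) *\<^sub>R (d - K z') = r - (\<tau> * \<sigma>) *\<^sub>R B"
  proof -
    have K_arg: "(\<tau> / \<alpha>) *\<^sub>R K (z' + (\<alpha> * \<sigma>) *\<^sub>R ?A (v' - v)) = (\<tau> / \<alpha>) *\<^sub>R K z' - (\<tau> * \<sigma>) *\<^sub>R B"
      using \<alpha> by (simp add: Ar K.diff K.scaleR B_def scaleR_diff_right)
    have "v' + (\<tau> / \<alpha>) *\<^sub>R d = v + ((\<tau> / \<alpha>) *\<^sub>R K z' - (\<tau> * \<sigma>) *\<^sub>R B)"
      by (simp only: eq K_arg)
    then show ?thesis by (simp add: r_def algebra_simps)
  qed
  then have "(\<alpha> / \<tau>) *\<^sub>R (\<tau> / \<alpha>) *\<^sub>R (d - K z') = (\<alpha> / \<tau>) *\<^sub>R (r - (\<tau> * \<sigma>) *\<^sub>R B)"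
    by simp
  then have e: "d - K z' = (\<alpha> / \<tau>) *\<^sub>R (r - (\<tau> * \<sigma>) *\<^sub>R B)"
    using \<alpha> \<tau> by simp
  have Bq: "B \<bullet> q = ?A r \<bullet> ?A q" and "B \<bullet> r = ?A r \<bullet> ?A r"
    unfolding B_def by (rule inner_adjoint[OF K])+
  then have Br: "r \<bullet> B = (norm (?A r))\<^sup>2"
    by (simp add: inner_commute power2_norm_eq_inner)
  \<comment> \<open>With S = \<open>\<sigma>\<tau> K K*\<close>, the stepsize bound yields S^2 \<le>
    S as quadratic forms, which for M = I - S says M^2 \<le> M.\<close>
  have "norm B \<le> onorm K * norm (?A r)"
    unfolding B_def by (rule onorm[OF K])
  then have "(norm B)\<^sup>2 \<le> (onorm K * norm (?A r))\<^sup>2"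
    by (rule power_mono) simp
  then have "\<sigma> * \<tau> * (norm B)\<^sup>2 \<le> \<sigma> * \<tau> * (onorm K * norm (?A r))\<^sup>2"
    using \<sigma> \<tau> by (intro mult_left_mono) auto
  also have "\<dots> \<le> (norm (?A r))\<^sup>2"
    using mult_right_mono[OF step, of "(norm (?A r))\<^sup>2"] by (simp add: power_mult_distrib mult.assoc)
  finally have "\<alpha>\<^sup>2 * \<sigma> * (\<sigma> * \<tau> * (norm B)\<^sup>2) \<le> \<alpha>\<^sup>2 * \<sigma> * (norm (?A r))\<^sup>2"
    using \<sigma> by (intro mult_left_mono) auto
  moreover have "\<tau> * (norm (K z' - d))\<^sup>2
      = \<alpha>\<^sup>2 / \<tau> * (norm r)\<^sup>2 - 2 * (\<alpha>\<^sup>2 * \<sigma> * (norm (?A r))\<^sup>2) + \<alpha>\<^sup>2 * \<sigma> * (\<sigma> * \<tau> * (norm B)\<^sup>2)"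
  proof -
    have sq: "(norm (r - (\<tau> * \<sigma>) *\<^sub>R B))\<^sup>2
        = (norm r)\<^sup>2 - 2 * (\<tau> * \<sigma>) * (norm (?A r))\<^sup>2 + (\<tau> * \<sigma>)\<^sup>2 * (norm B)\<^sup>2"
      unfolding Br[symmetric] by (simp add: power2_norm_eq_inner inner_diff inner_commute power2_eq_square[of "\<tau> * \<sigma>"])
    show ?thesis
      unfolding norm_minus_commute[of "K z'"] e norm_scaleR power_mult_distrib[of "\<bar>_\<bar>"] sq
      using \<tau> by (simp add: power2_eq_square field_simps)
  qed
  moreover have "\<alpha> * ((d - K z') \<bullet> q) = \<alpha>\<^sup>2 / \<tau> * (r \<bullet> q) - \<alpha>\<^sup>2 * \<sigma> * (?A r \<bullet> ?A q)"
    using \<tau> by (simp add: e inner_diff_left Bq power2_eq_square field_simps)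
  moreover have "\<alpha>\<^sup>2 / (2 * \<tau>) * ((norm (v - w))\<^sup>2 - (norm q)\<^sup>2)
      = \<alpha>\<^sup>2 / \<tau> * (norm r)\<^sup>2 / 2 + \<alpha>\<^sup>2 / \<tau> * (r \<bullet> q)"
    unfolding vw using \<tau>
    by (simp add: power2_norm_eq_inner inner_add inner_commute field_simps)
  moreover have "\<alpha>\<^sup>2 * \<sigma> / 2 * ((norm (?A q))\<^sup>2 - (norm (?A (v - w)))\<^sup>2)
      = - (\<alpha>\<^sup>2 * \<sigma> * (norm (?A r))\<^sup>2 / 2) - \<alpha>\<^sup>2 * \<sigma> * (?A r \<bullet> ?A q)"
    unfolding Avw
    by (simp add: power2_norm_eq_inner inner_add inner_commute field_simps)
  ultimately show ?thesis unfolding q_def[symmetric] by argo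
qed

section \<open>Convexity of the conjugate and the Lagrangian gap\<close>

text \<open>A point where \<open>h\<close> is finite provides an affine minorant of the
  conjugate.\<close>

lemma conjugate_not_MInfty:
  assumes "proper h"
  shows "conjugate h u \<noteq> -\<infinity>"
proof -
  obtain p where "h p \<noteq> \<infinity>" "h p \<noteq> -\<infinity>" using assms by (auto simp: proper_def)
  then obtain r where "h p = ereal r" by (cases "h p") auto
  moreover have "ereal (p \<bullet> u) - h p \<le> conjugate h u"
    unfolding conjugate_def by (rule SUP_upper) simp
  ultimately show ?thesis by auto
qed

text \<open>Adding the quadratic back to the convex remainder contributes exactly its convexity
  defect, computed in \<open>norm_convex_combination\<close>.\<close>

lemma strongly_convex_ereal_ineq:
  fixes \<phi> :: "'a::real_inner \<Rightarrow> ereal"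
  assumes conv: "convex_ereal (\<lambda>w. \<phi> w - ereal (\<mu> / 2 * (norm w)\<^sup>2))"
    and p: "\<phi> p = ereal P" and q: "\<phi> q = ereal Q" and s: "0 \<le> s" "s \<le> 1"
  shows "\<phi> ((1 - s) *\<^sub>R p + s *\<^sub>R q)
    \<le> ereal ((1 - s) * P + s * Q - \<mu> / 2 * (s * (1 - s)) * (norm (p - q))\<^sup>2)"
proof -
  let ?w = "(1 - s) *\<^sub>R p + s *\<^sub>R q"
  have "\<phi> ?w - ereal (\<mu> / 2 * (norm ?w)\<^sup>2)
      \<le> ereal ((1 - s) * (P - \<mu> / 2 * (norm p)\<^sup>2) + s * (Q - \<mu> / 2 * (norm q)\<^sup>2))"
    using conv[unfolded convex_ereal_def, rule_format, of s p q] s by (simp add: p q)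
  moreover have "\<mu> / 2 * (norm ?w)\<^sup>2 = (1 - s) * (\<mu> / 2 * (norm p)\<^sup>2) + s * (\<mu> / 2 * (norm q)\<^sup>2)
      - \<mu> / 2 * (s * (1 - s)) * (norm (p - q))\<^sup>2"
    unfolding norm_convex_combination by (simp add: field_simps)
  ultimately show ?thesis by (cases "\<phi> ?w") (auto simp: algebra_simps)
qed

text \<open>The subgradient inequality is tested at a point of the segment close to
  \<open>p\<close>, and compared with strong convexity there. Division by \<open>s\<close> leaves
  the factor \<open>1 - s\<close> on the modulus, which tends to 1.\<close>

lemma strong_subgradient_ineq:
  fixes \<phi> :: "'a::real_inner \<Rightarrow> ereal"
  assumes conv: "convex_ereal (\<lambda>w. \<phi> w - ereal (\<mu> / 2 * (norm w)\<^sup>2))"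
    and p: "\<phi> p = ereal P" and q: "\<phi> q = ereal Q" and d: "d \<in> subdifferential \<phi> p"
  shows "P + d \<bullet> (q - p) + \<mu> / 2 * (norm (p - q))\<^sup>2 \<le> Q"
proof -
  define m where "m = \<mu> / 2 * (norm (p - q))\<^sup>2"
  have le: "P + d \<bullet> (q - p) + (1 - s) * m \<le> Q" if s: "0 < s" "s < 1" for s
  proof -
    have w: "(1 - s) *\<^sub>R p + s *\<^sub>R q - p = s *\<^sub>R (q - p)" by (simp add: algebra_simps)
    have "\<phi> p + ereal (d \<bullet> ((1 - s) *\<^sub>R p + s *\<^sub>R q - p)) \<le> \<phi> ((1 - s) *\<^sub>R p + s *\<^sub>R q)"
      using d unfolding subdifferential_def by blast
    also have "\<dots> \<le> ereal ((1 - s) * P + s * Q - \<mu> / 2 * (s * (1 - s)) * (norm (p - q))\<^sup>2)"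
      using strongly_convex_ereal_ineq[OF conv p q] s by simp
    finally have "s * (P + d \<bullet> (q - p) + (1 - s) * m) \<le> s * Q"
      unfolding p w by (simp add: m_def algebra_simps)
    then show ?thesis using s by simp
  qed
  have "((\<lambda>s. P + d \<bullet> (q - p) + (1 - s) * m) \<longlongrightarrow> P + d \<bullet> (q - p) + (1 - 0) * m) (at_right 0)"
    by (intro tendsto_intros)
  moreover have "\<forall>\<^sub>F s in at_right 0. P + d \<bullet> (q - p) + (1 - s) * m \<le> Q"
    unfolding eventually_at_right_field using le by (intro exI[of _ 1]) auto
  ultimately show ?thesis
    using tendsto_upperbound[of _ _ "at_right (0::real)" Q] by (fastforce simp: m_def)
qed

lemma Lagrangian_gap_ereal:
  assumes "conjugate h us = ereal Ps" and "conjugate h u = ereal P"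
  shows "Lagrangian_gap f \<mu> h K xs us x u
    = ereal (f x + \<mu> / 2 * (norm x)\<^sup>2 + K x \<bullet> us - Ps - (f xs + \<mu> / 2 * (norm xs)\<^sup>2 + K xs \<bullet> u - P))"
  by (simp add: Lagrangian_gap_def Lagrangian_def assms)

lemma Lagrangian_gap_PInfty:
  assumes "conjugate h us = ereal Ps" and "conjugate h u = \<infinity>"
  shows "Lagrangian_gap f \<mu> h K xs us x u = \<infinity>"
  by (simp add: Lagrangian_gap_def Lagrangian_def assms)

section \<open>Assembling the one-step inequality\<close>

theorem theorem3p1:
  fixes f :: "'x::{real_inner, complete_space} \<Rightarrow> real"
    and h :: "'u::{real_inner, complete_space} \<Rightarrow> ereal"
    and K :: "'x \<Rightarrow> 'u"
    and L\<^sub>f \<mu>\<^sub>g \<mu>\<^sub>h \<gamma> \<tau> :: real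
    and a :: "nat \<Rightarrow> real"
    and x y z zhat :: "nat \<Rightarrow> 'x"
    and u v d :: "nat \<Rightarrow> 'u"
    and xs :: 'x and us :: 'u
    and t :: nat
  assumes f_convex: "convex_on UNIV f"
    and f_differentiable: "\<And>p. f differentiable (at p)"
    and f_smooth: "L\<^sub>f-lipschitz_on UNIV (gradient f)"
    and L\<^sub>f_pos: "L\<^sub>f > 0"
    and \<mu>\<^sub>g_nonneg: "\<mu>\<^sub>g \<ge> 0"
    and L\<^sub>f_ge: "L\<^sub>f \<ge> \<mu>\<^sub>g"
    and h_proper: "proper h"
    and h_lsc: "lower_semicontinuous h"
    and h_convex: "convex_ereal h"
    and K_bounded_linear: "bounded_linear K"
    and K_nonzero: "K \<noteq> (\<lambda>_. 0)"
    and \<mu>\<^sub>h_nonneg: "\<mu>\<^sub>h \<ge> 0"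
    and conj_strongly_convex:
      "convex_ereal (\<lambda>w. conjugate h w - ereal (\<mu>\<^sub>h / 2 * (norm w)\<^sup>2))"
    and \<gamma>_pos: "\<gamma> > 0" and \<tau>_pos: "\<tau> > 0"
    and a_0: "a 0 \<ge> 0" and a_ge_1: "\<And>k. k \<ge> 1 \<Longrightarrow> a k \<ge> 1"
    and primal_opt: "0 = gradient f xs + \<mu>\<^sub>g *\<^sub>R xs + adjoint K us"
    and dual_opt: "K xs \<in> subdifferential (conjugate h) us"
    and iterates: "APAPC f \<mu>\<^sub>g h K \<gamma> \<tau> a x y z zhat u v"
    and d_subgradient: "\<And>k. d k \<in> subdifferential (conjugate h) (v (Suc k))"
    and d_eq: "\<And>k. v (Suc k) + (\<tau> / a (Suc k)) *\<^sub>R d k = v k + (\<tau> / a (Suc k)) *\<^sub>R K (zhat k)"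
    and stepsize: "\<gamma> * \<tau> * (onorm K)\<^sup>2 \<le> 1 + a (Suc t) * \<gamma> * \<mu>\<^sub>g"
  shows
    "ereal ((1 + a (Suc t) * \<gamma> * \<mu>\<^sub>g) / (2 * \<gamma>) * (norm (z (Suc t) - xs))\<^sup>2
        + ((a (Suc t))\<^sup>2 + a (Suc t) * \<tau> * \<mu>\<^sub>h) / (2 * \<tau>) * (norm (v (Suc t) - us))\<^sup>2
        - (a (Suc t))\<^sup>2 * \<gamma> / (2 + 2 * a (Suc t) * \<gamma> * \<mu>\<^sub>g)
            * (norm (adjoint K (v (Suc t) - us)))\<^sup>2)
      + ereal ((a (Suc t))\<^sup>2) * Lagrangian_gap f \<mu>\<^sub>g h K xs us (x (Suc t)) (u (Suc t))
     \<le> ereal (1 / (2 * \<gamma>) * (norm (z t - xs))\<^sup>2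
        + (a (Suc t))\<^sup>2 / (2 * \<tau>) * (norm (v t - us))\<^sup>2
        - (a (Suc t))\<^sup>2 * \<gamma> / (2 + 2 * a (Suc t) * \<gamma> * \<mu>\<^sub>g)
            * (norm (adjoint K (v t - us)))\<^sup>2
        - (1 / (2 * \<gamma>) - L\<^sub>f / 2) * (norm (z (Suc t) - z t))\<^sup>2
        - \<tau> / 2 * (norm (K (z (Suc t)) - d t))\<^sup>2)
      + ereal ((a (Suc t))\<^sup>2 - a (Suc t)) * Lagrangian_gap f \<mu>\<^sub>g h K xs us (x t) (u t)
      - ereal (a (Suc t) / (2 * L\<^sub>f) * (norm (gradient f (y t) - gradient f xs))\<^sup>2)
      - ereal (((a (Suc t))\<^sup>2 - a (Suc t)) / (2 * L\<^sub>f)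
            * (norm (gradient f (x t) - gradient f (y t)))\<^sup>2)"
proof -
  define \<alpha> where "\<alpha> = a (Suc t)"
  define H where "H = conjugate h"
  define c where "c = 1 + \<alpha> * \<gamma> * \<mu>\<^sub>g"
  have \<alpha>: "\<alpha> \<ge> 1" using a_ge_1 by (simp add: \<alpha>_def)
  have c: "c \<ge> 1" using \<alpha> \<gamma>_pos \<mu>\<^sub>g_nonneg by (simp add: c_def)
  have y: "y t = (1 - 1 / \<alpha>) *\<^sub>R x t + (1 / \<alpha>) *\<^sub>R z t"
    and zhat: "zhat t = inverse c *\<^sub>R
        (z t - (\<alpha> * \<gamma>) *\<^sub>R gradient f (y t) - (\<alpha> * \<gamma>) *\<^sub>R adjoint K (v t))"
    and z': "z (Suc t) = inverse c *\<^sub>R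
        (z t - (\<alpha> * \<gamma>) *\<^sub>R gradient f (y t) - (\<alpha> * \<gamma>) *\<^sub>R adjoint K (v (Suc t)))"
    and x': "x (Suc t) = (1 - 1 / \<alpha>) *\<^sub>R x t + (1 / \<alpha>) *\<^sub>R z (Suc t)"
    and u': "u (Suc t) = (1 - 1 / \<alpha>) *\<^sub>R u t + (1 / \<alpha>) *\<^sub>R v (Suc t)"
    using iterates unfolding APAPC_def \<alpha>_def c_def by blast+
  interpret K: bounded_linear K by fact

  have Hu: "H w \<noteq> -\<infinity>" for w
    using conjugate_not_MInfty[OF h_proper] by (simp add: H_def)
  \<comment> \<open>Membership in \<open>subdifferential\<close> includes finiteness, which settles
    \<open>us\<close> and \<open>v (Suc t)\<close>. \<open>H (u t)\<close> may be infinite, since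
    \<open>u 0\<close> is arbitrary; hence the case analysis at the end.\<close>
  obtain Ps where Ps: "H us = ereal Ps"
    using dual_opt unfolding subdifferential_def H_def by (cases "conjugate h us") auto
  obtain Pv where Pv: "H (v (Suc t)) = ereal Pv"
    using d_subgradient[of t] unfolding subdifferential_def H_def
    by (cases "conjugate h (v (Suc t))") auto

  \<comment> \<open>The two updates differ only in the dual variable. This brings
    \<open>d_eq\<close> into the form of \<open>dual_step\<close> with \<sigma> =
    \<open>\<gamma> / c\<close>; dividing the stepsize condition by \<open>c\<close> gives the
    matching bound.\<close>
  have "zhat t = z (Suc t) + (\<alpha> * (\<gamma> / c)) *\<^sub>R adjoint K (v (Suc t) - v t)"
    unfolding zhat z' adjoint_diff[OF K_bounded_linear]
    by (simp add: divide_inverse algebra_simps)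
  then have "v (Suc t) + (\<tau> / \<alpha>) *\<^sub>R d t
      = v t + (\<tau> / \<alpha>) *\<^sub>R K (z (Suc t) + (\<alpha> * (\<gamma> / c)) *\<^sub>R adjoint K (v (Suc t) - v t))"
    using d_eq[of t] unfolding \<alpha>_def by simp
  moreover have "\<gamma> / c * \<tau> * (onorm K)\<^sup>2 \<le> 1"
    using stepsize c by (simp add: c_def \<alpha>_def field_simps)
  ultimately have dual: "\<alpha> * ((d t - K (z (Suc t))) \<bullet> (v (Suc t) - us))
      \<le> \<alpha>\<^sup>2 / (2 * \<tau>) * ((norm (v t - us))\<^sup>2 - (norm (v (Suc t) - us))\<^sup>2)
      + \<alpha>\<^sup>2 * (\<gamma> / c) / 2 * ((norm (adjoint K (v (Suc t) - us)))\<^sup>2 - (norm (adjoint K (v t - us)))\<^sup>2)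
      - \<tau> / 2 * (norm (K (z (Suc t)) - d t))\<^sup>2"
    using \<alpha> \<gamma>_pos \<tau>_pos c by (intro dual_step[OF K_bounded_linear]) auto
  have primal: "\<alpha>\<^sup>2 * (f (x (Suc t)) + \<mu>\<^sub>g / 2 * (norm (x (Suc t)))\<^sup>2)
      - (\<alpha>\<^sup>2 - \<alpha>) * (f (x t) + \<mu>\<^sub>g / 2 * (norm (x t))\<^sup>2)
      - \<alpha> * (f xs + \<mu>\<^sub>g / 2 * (norm xs)\<^sup>2)
    \<le> 1 / (2 * \<gamma>) * (norm (z t - xs))\<^sup>2 - c / (2 * \<gamma>) * (norm (z (Suc t) - xs))\<^sup>2
      - (1 / (2 * \<gamma>) - L\<^sub>f / 2) * (norm (z (Suc t) - z t))\<^sup>2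
      - \<alpha> * (adjoint K (v (Suc t)) \<bullet> (z (Suc t) - xs))
      - \<alpha> / (2 * L\<^sub>f) * (norm (gradient f (y t) - gradient f xs))\<^sup>2
      - (\<alpha>\<^sup>2 - \<alpha>) / (2 * L\<^sub>f) * (norm (gradient f (x t) - gradient f (y t)))\<^sup>2"
    unfolding c_def
    by (rule primal_step[OF f_convex f_differentiable f_smooth L\<^sub>f_pos \<mu>\<^sub>g_nonneg \<gamma>_pos \<alpha> y
          z'[unfolded c_def] x'])
  have "Pv + d t \<bullet> (us - v (Suc t)) + \<mu>\<^sub>h / 2 * (norm (v (Suc t) - us))\<^sup>2 \<le> Ps"
    by (rule strong_subgradient_ineq[OF conj_strongly_convex Pv[unfolded H_def] Ps[unfolded H_def]
          d_subgradient])
  then have "\<alpha> * (Pv + d t \<bullet> (us - v (Suc t)) + \<mu>\<^sub>h / 2 * (norm (v (Suc t) - us))\<^sup>2) \<le> \<alpha> * Ps"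
    using \<alpha> by (simp add: mult_left_mono)
  then have subgrad: "\<alpha> * Pv - \<alpha> * Ps \<le> \<alpha> * (d t \<bullet> (v (Suc t) - us))
      - \<alpha> * \<mu>\<^sub>h / 2 * (norm (v (Suc t) - us))\<^sup>2"
    by (simp add: inner_diff_right algebra_simps)
  have adj: "adjoint K (v (Suc t)) \<bullet> (z (Suc t) - xs) = (K (z (Suc t)) - K xs) \<bullet> v (Suc t)"
    using inner_adjoint[OF K_bounded_linear, of "z (Suc t) - xs" "v (Suc t)"]
    by (simp add: K.diff inner_commute)
  have coef: "(\<alpha>\<^sup>2 + \<alpha> * \<tau> * \<mu>\<^sub>h) / (2 * \<tau>) = \<alpha>\<^sup>2 / (2 * \<tau>) + \<alpha> * \<mu>\<^sub>h / 2"
    "\<alpha>\<^sup>2 * \<gamma> / (2 + 2 * \<alpha> * \<gamma> * \<mu>\<^sub>g) = \<alpha>\<^sup>2 * (\<gamma> / c) / 2"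
    using \<tau>_pos c by (simp_all add: c_def field_simps)

  let ?F = "\<lambda>p. f p + \<mu>\<^sub>g / 2 * (norm p)\<^sup>2"
  define A where "A = c / (2 * \<gamma>) * (norm (z (Suc t) - xs))\<^sup>2
        + (\<alpha>\<^sup>2 + \<alpha> * \<tau> * \<mu>\<^sub>h) / (2 * \<tau>) * (norm (v (Suc t) - us))\<^sup>2
        - \<alpha>\<^sup>2 * \<gamma> / (2 + 2 * \<alpha> * \<gamma> * \<mu>\<^sub>g) * (norm (adjoint K (v (Suc t) - us)))\<^sup>2"
  define B where "B = 1 / (2 * \<gamma>) * (norm (z t - xs))\<^sup>2
        + \<alpha>\<^sup>2 / (2 * \<tau>) * (norm (v t - us))\<^sup>2
        - \<alpha>\<^sup>2 * \<gamma> / (2 + 2 * \<alpha> * \<gamma> * \<mu>\<^sub>g) * (norm (adjoint K (v t - us)))\<^sup>2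
        - (1 / (2 * \<gamma>) - L\<^sub>f / 2) * (norm (z (Suc t) - z t))\<^sup>2
        - \<tau> / 2 * (norm (K (z (Suc t)) - d t))\<^sup>2"
  define C where "C = \<alpha> / (2 * L\<^sub>f) * (norm (gradient f (y t) - gradient f xs))\<^sup>2"
  define D where "D = (\<alpha>\<^sup>2 - \<alpha>) / (2 * L\<^sub>f) * (norm (gradient f (x t) - gradient f (y t)))\<^sup>2"
  let ?G = "Lagrangian_gap f \<mu>\<^sub>g h K xs us"

  \<comment> \<open>The pairings with \<open>K\<close> from the primal bound and from the gap
    combine with the subgradient term to \<open>\<alpha> * ((d t - K (z (Suc t))) \<bullet> (v (Suc
    t) - us))\<close>, which is what \<open>dual\<close> bounds.\<close>
  have sum_bound: "A + (\<alpha>\<^sup>2 * ?F (x (Suc t)) - (\<alpha>\<^sup>2 - \<alpha>) * ?F (x t) - \<alpha> * ?F xs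
      + \<alpha> * (K (z (Suc t)) \<bullet> us) - \<alpha> * (K xs \<bullet> v (Suc t)) + \<alpha> * Pv - \<alpha> * Ps) \<le> B - C - D"
    using primal dual subgrad unfolding A_def B_def C_def D_def coef adj
    by (simp add: inner_diff_left inner_diff_right inner_commute algebra_simps)

  \<comment> \<open>Averaging with weight \<open>1 / \<alpha>\<close>, multiplied by \<alpha>^2,
    puts \<open>\<alpha>^2 - \<alpha>\<close> on the old point and \<alpha> on the new one, so the
    bilinear terms of the old gap cancel exactly.\<close>
  have "K (x (Suc t)) = (1 - 1 / \<alpha>) *\<^sub>R K (x t) + (1 / \<alpha>) *\<^sub>R K (z (Suc t))"
    unfolding x' by (simp only: K.add K.scaleR)
  then have Kx: "\<alpha>\<^sup>2 * (K (x (Suc t)) \<bullet> us) = (\<alpha>\<^sup>2 - \<alpha>) * (K (x t) \<bullet> us) + \<alpha> * (K (z (Suc t)) \<bullet> us)"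
    using \<alpha> by (simp add: inner_add_left power2_eq_square field_simps)
  have Kxs: "\<alpha>\<^sup>2 * (K xs \<bullet> u (Suc t)) = (\<alpha>\<^sup>2 - \<alpha>) * (K xs \<bullet> u t) + \<alpha> * (K xs \<bullet> v (Suc t))"
    using \<alpha> by (simp add: u' inner_add_right power2_eq_square field_simps)

  \<comment> \<open>The weight \<open>\<alpha>^2 - \<alpha>\<close> vanishes for \<alpha> = 1 and is
    positive otherwise. In the latter case an infinite \<open>H (u t)\<close> makes the right-hand
    side infinite, and a finite one reduces the claim to real numbers.\<close>
  have "ereal A + ereal (\<alpha>\<^sup>2) * ?G (x (Suc t)) (u (Suc t))
      \<le> ereal B + ereal (\<alpha>\<^sup>2 - \<alpha>) * ?G (x t) (u t) - ereal C - ereal D"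
  proof (cases "\<alpha> = 1")
    case True
    \<comment> \<open>The old gap may be infinite here, but it has weight 0; \<open>u (Suc t) = v (Suc t)\<close>.\<close>
    have G: "?G (x (Suc t)) (u (Suc t))
        = ereal (?F (x (Suc t)) + K (x (Suc t)) \<bullet> us - Ps - (?F xs + K xs \<bullet> u (Suc t) - Pv))"
      using Lagrangian_gap_ereal[OF Ps[unfolded H_def], of "u (Suc t)" Pv] Pv True
      by (simp add: u' H_def)
    show ?thesis
      using sum_bound Kx Kxs True unfolding G by (simp add: algebra_simps flip: zero_ereal_def)
  next
    case False
    then have \<alpha>2': "\<alpha>\<^sup>2 - \<alpha> > 0" using \<alpha> by (simp add: power2_eq_square)
    show ?thesis
    proof (cases "H (u t)")
      case (real P)
      have "H (u (Suc t)) \<le> ereal ((1 - 1 / \<alpha>) * P + 1 / \<alpha> * Pv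
          - \<mu>\<^sub>h / 2 * (1 / \<alpha> * (1 - 1 / \<alpha>)) * (norm (u t - v (Suc t)))\<^sup>2)"
        unfolding u' using \<alpha>
        by (intro strongly_convex_ereal_ineq conj_strongly_convex[folded H_def] real Pv) auto
      also have "\<dots> \<le> ereal ((1 - 1 / \<alpha>) * P + 1 / \<alpha> * Pv)"
        using \<mu>\<^sub>h_nonneg \<alpha> by simp
      finally have le: "H (u (Suc t)) \<le> ereal ((1 - 1 / \<alpha>) * P + 1 / \<alpha> * Pv)" .
      then obtain P' where P': "H (u (Suc t)) = ereal P'"
        using Hu[of "u (Suc t)"] by (cases "H (u (Suc t))") auto
      then have "\<alpha>\<^sup>2 * P' \<le> \<alpha>\<^sup>2 * ((1 - 1 / \<alpha>) * P + 1 / \<alpha> * Pv)"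
        using le by (intro mult_left_mono) auto
      also have "\<dots> = (\<alpha>\<^sup>2 - \<alpha>) * P + \<alpha> * Pv"
        using \<alpha> by (simp add: power2_eq_square field_simps)
      finally have P'_le: "\<alpha>\<^sup>2 * P' \<le> (\<alpha>\<^sup>2 - \<alpha>) * P + \<alpha> * Pv" .
      have "A + \<alpha>\<^sup>2 * (?F (x (Suc t)) + K (x (Suc t)) \<bullet> us - Ps - (?F xs + K xs \<bullet> u (Suc t) - P'))
          \<le> B + (\<alpha>\<^sup>2 - \<alpha>) * (?F (x t) + K (x t) \<bullet> us - Ps - (?F xs + K xs \<bullet> u t - P)) - C - D"
        using sum_bound Kx Kxs P'_le unfolding distrib_left left_diff_distrib right_diff_distrib
        by linarith
      then show ?thesis
        by (simp add: Lagrangian_gap_ereal[OF Ps[unfolded H_def] P'[unfolded H_def]]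
            Lagrangian_gap_ereal[OF Ps[unfolded H_def] real[unfolded H_def]])
    next
      case PInf
      then have "?G (x t) (u t) = \<infinity>"
        by (intro Lagrangian_gap_PInfty[OF Ps[unfolded H_def]]) (simp add: H_def)
      then show ?thesis using \<alpha>2' by simp
    qed (use Hu in auto)
  qed
  then show ?thesis
    unfolding A_def B_def C_def D_def c_def \<alpha>_def .
qed

end
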